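(* Let $d\ge 1$ and let $f:[0,1]^d\to\mathbb{R}$ be a function of bounded Hardy--Krause variation, i.e. $HK(f;[0,1]^d)<\infty$. Then $f$ is Borel measurable, i.e. $f$ is measurable as a map from $\left([0,1]^d,\mathcal{B}([0,1]^d)\right)$ to $\left(\mathbb{R},\mathcal{B}(\mathbb{R})\right)$, where $\mathcal{B}(\cdot)$ denotes the Borel $\sigma$-algebra.
   Context: Hardy--Krause variation. For points $\mathbf{a},\mathbf{b}\in[0,1]^d$ and $u\subseteq\{1,\dots,d\}$, let $\mathbf{a}^u:\mathbf{b}^{-u}$ denote the point whose $i$-th coordinate is $a_i$ if $i\in u$ and $b_i$ if $i\notin u$. For $\mathbf{a}\le\mathbf{b}$ (coordinatewise) put $$\Delta_u(f;[\mathbf{a},\mathbf{b}])=\sum_{v\subseteq u}(-1)^{|v|}f(\mathbf{a}^v:\mathbf{b}^{-v}).$$ A one-dimensional ladder is a finite set $\{0=y_1<y_2<\dots<y_k<1\}$ (with $k\ge1$); the successor of $y_i$ is $(y_i)_+=y_{i+1}$ if $i<k$, and $(y_k)_+=1$. A ladder in $[0,1]^d$ is a product $\mathcal{Y}=\prod_{j=1}^d\mathcal{Y}^j$ of one-dimensional ladders; let $\mathbb{Y}$ be the set of all ladders in $[0,1]^d$. Let $\mathbf{1}=(1,\dots,1)$. For $\emptyset\ne u\subseteq\{1,\dots,d\}$ let $\mathcal{Y}_u=\{\mathbf{y}^u:\mathbf{1}^{-u}\mid\mathbf{y}\in\mathcal{Y}\}$. For $\mathbf{y}\in\mathcal{Y}_u$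 the successor $\mathbf{y}_+$ is obtained by replacing each coordinate $y_i$ with $i\in u$ by its successor in $\mathcal{Y}^i$, and leaving the coordinates with $i\notin u$ equal to $1$. Put $$V_{\mathcal{Y}_u}(f;[0,1]^d)=\sum_{\mathbf{y}\in\mathcal{Y}_u}|\Delta_u(f;[\mathbf{y},\mathbf{y}_+])|,\qquad HK(f;[0,1]^d)=\sum_{\emptyset\neq u\subseteq\{1,\dots,d\}}\ \sup_{\mathcal{Y}\in\mathbb{Y}}V_{\mathcal{Y}_u}(f;[0,1]^d).$$ *)

theory Defs
  imports "HOL-Analysis.Analysis"
begin

text \<open>
  Points of \<open>[0,1]\<^sup>d\<close> are vectors of type \<^typ>\<open>real ^ 'n\<close> with \<open>d = CARD('n)\<close>, and the coordinate
  index set \<open>{1,\<dots>,d}\<close> is the finite type \<open>'n\<close>. A function on \<open>[0,1]\<^sup>d\<close> is a function on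
  \<^typ>\<open>real ^ 'n\<close>; everything below evaluates it at points
  of the unit cube \<^term>\<open>cbox 0 1 :: (real ^ 'n) set\<close> only.
\<close>

text \<open>\<open>glue u a b\<close> is \<open>a\<^sup>u : b\<^sup>-\<^sup>u\<close>.\<close>

definition glue :: "'n set \<Rightarrow> real ^ 'n \<Rightarrow> real ^ 'n \<Rightarrow> real ^ 'n" where
  "glue u a b = (\<chi> i. if i \<in> u then a $ i else b $ i)"

definition Delta :: "'n::finite set \<Rightarrow> (real ^ 'n \<Rightarrow> real) \<Rightarrow> real ^ 'n \<Rightarrow> real ^ 'n \<Rightarrow> real" where
  "Delta u f a b = (\<Sum>v\<in>Pow u. (-1) ^ card v * f (glue v a b))"

definition ladder1 :: "real set \<Rightarrow> bool" where
  "ladder1 L \<longleftrightarrow> finite L \<and> 0 \<in> L \<and> L \<subseteq> {0..<1}"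

definition ladder_succ :: "real set \<Rightarrow> real \<Rightarrow> real" where
  "ladder_succ L y = (if \<exists>z\<in>L. y < z then Min {z \<in> L. y < z} else 1)"

text \<open>
  A ladder in \<open>[0,1]\<^sup>d\<close> is given by the family \<open>Y\<close> of its one-dimensional factors, which the product
  set determines since the factors are nonempty; the product set itself is \<open>ladder_points Y\<close>.
\<close>

definition ladders :: "('n \<Rightarrow> real set) set" where
  "ladders = {Y. \<forall>j. ladder1 (Y j)}"

definition ladder_points :: "('n \<Rightarrow> real set) \<Rightarrow> (real ^ 'n) set" where
  "ladder_points Y = {y. \<forall>j. y $ j \<in> Y j}"

definition ladder_face :: "('n::finite \<Rightarrow> real set) \<Rightarrow> 'n set \<Rightarrow> (real ^ 'n::finite) set" where
  "ladder_face Y u = {glue u y 1 | y. y \<in> ladder_points Y}"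

definition face_succ :: "('n \<Rightarrow> real set) \<Rightarrow> 'n set \<Rightarrow> real ^ 'n \<Rightarrow> real ^ 'n" where
  "face_succ Y u y = (\<chi> i. if i \<in> u then ladder_succ (Y i) (y $ i) else 1)"

definition ladder_variation ::
    "('n::finite \<Rightarrow> real set) \<Rightarrow> 'n set \<Rightarrow> (real ^ 'n \<Rightarrow> real) \<Rightarrow> real" where
  "ladder_variation Y u f = (\<Sum>y\<in>ladder_face Y u. \<bar>Delta u f y (face_succ Y u y)\<bar>)"

definition HK :: "(real ^ 'n::finite \<Rightarrow> real) \<Rightarrow> ennreal" where
  "HK f = (\<Sum>u\<in>{u :: 'n set. u \<noteq> {}}. SUP Y\<in>ladders. ennreal (ladder_variation Y u f))"

text \<open>
  \<^const>\<open>sum\<close> is \<open>0\<close> over an infinite set; the sum in \<^const>\<open>ladder_variation\<close> is over a finite one.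
\<close>

lemma finite_ladder_face:
  fixes Y :: "'n::finite \<Rightarrow> real set"
  assumes "Y \<in> ladders"
  shows "finite (ladder_face Y u)"
proof -
  have "ladder_points Y \<subseteq> vec_lambda ` (PiE UNIV Y)"
  proof
    fix y :: "real ^ 'n" assume "y \<in> ladder_points Y"
    then have "vec_nth y \<in> PiE UNIV Y" by (auto simp: ladder_points_def)
    then show "y \<in> vec_lambda ` (PiE UNIV Y)" by (metis image_eqI vec_nth_inverse)
  qed
  moreover have "finite (PiE UNIV Y)"
    using assms by (intro finite_PiE) (auto simp: ladders_def ladder1_def)
  ultimately have "finite (ladder_points Y)" by (meson finite_imageI finite_subset)
  moreover have "ladder_face Y u = (\<lambda>y. glue u y 1) ` ladder_points Y"
    by (auto simp: ladder_face_def)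
  ultimately show ?thesis by simp
qed

end

theory Submission
  imports Defs
begin

text \<open>
  For \<open>d \<ge> 2\<close> a function monotone in each coordinate need not be Borel, so a decomposition into monotone
  functions of several variables does not settle the matter. Hardy--Krause variation gives more: the
  increments of \<open>f\<close> in direction \<open>i\<close> are controlled uniformly in the other coordinates by a single
  monotone function \<open>\<phi>\<^sub>i\<close> of one real variable, in the sense that
  \<open>\<bar>f x - f y\<bar> \<le> (\<Sum>i. \<bar>\<phi>\<^sub>i (x\<^sub>i) - \<phi>\<^sub>i (y\<^sub>i)\<bar>)\<close> on the cube (\<open>increment_le_sum_coord_variation\<close>).
  Hence \<open>f\<close> is a Lipschitz function of \<open>\<Phi> x = (\<phi>\<^sub>1 (x\<^sub>1), \<dots>, \<phi>\<^sub>d (x\<^sub>d))\<close>. It extends continuously to the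
  closure of the range of \<open>\<Phi>\<close>, and \<open>\<Phi>\<close> is Borel because monotone functions on the line are; so \<open>f\<close>
  is the composition of a continuous and a Borel map (\<open>borel_measurable_of_dist_le\<close>).

  The value \<open>\<phi>\<^sub>i t\<close> is the supremum of \<open>\<Sum> \<bar>f q - f p\<bar>\<close> over finite families of segments \<open>[p, q]\<close> in
  direction \<open>i\<close> whose projections to the \<open>i\<close>-axis lie below \<open>t\<close> and do not overlap, while the other
  coordinates vary freely from one segment to the next. The point is that these sums are bounded by
  \<open>HK f\<close> (\<open>segment_family_sum_le_HK\<close>). To see this, take a ladder containing all coordinates that
  occur. On its grid, \<open>f x\<close> is the signed sum of the cell differences of \<open>f\<close> over all cells \<open>z \<ge> x\<close>,
  the cells of all faces \<open>\<Y>\<^sub>u\<close> being counted (\<open>reconstruction\<close>). Therefore \<open>f q - f p\<close> only involves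
  cells in the slab \<open>p\<^sub>i \<le> z\<^sub>i < q\<^sub>i\<close>, and the slabs of different segments are disjoint.
\<close>

section \<open>Reconstructing a function from its cell differences\<close>

text \<open>
  Since ladders avoid \<open>1\<close>, the grid of the ladder with \<open>1\<close> adjoined to each factor is the disjoint
  union of the faces \<open>\<Y>\<^sub>u\<close> over all \<open>u\<close>, including the corner for \<open>u = {}\<close>; a point lies in the face of
  its set of coordinates different from \<open>1\<close>. One sum over this grid thus replaces the sums over \<open>u\<close>
  and over \<open>\<Y>\<^sub>u\<close> in the Hardy--Krause variation.
\<close>

definition closed_grid :: "('n::finite \<Rightarrow> real set) \<Rightarrow> (real ^ 'n) set" where
  "closed_grid Y = {z. \<forall>j. z $ j \<in> insert 1 (Y j)}"

definition active :: "real ^ 'n::finite \<Rightarrow> 'n set" where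
  "active z = {j. z $ j \<noteq> 1}"

definition cell_diff :: "('n::finite \<Rightarrow> real set) \<Rightarrow> (real ^ 'n \<Rightarrow> real) \<Rightarrow> real ^ 'n \<Rightarrow> real" where
  "cell_diff Y f z = Delta (active z) f z (face_succ Y (active z) z)"

lemma finite_closed_grid:
  assumes "Y \<in> ladders"
  shows "finite (closed_grid Y)"
proof -
  have "closed_grid Y \<subseteq> vec_lambda ` (PiE UNIV (\<lambda>j. insert 1 (Y j)))"
  proof
    fix z assume "z \<in> closed_grid Y"
    then have "vec_nth z \<in> PiE UNIV (\<lambda>j. insert 1 (Y j))" by (auto simp: closed_grid_def)
    then show "z \<in> vec_lambda ` (PiE UNIV (\<lambda>j. insert 1 (Y j)))" by (metis image_eqI vec_nth_inverse)
  qed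
  moreover have "finite (PiE UNIV (\<lambda>j. insert 1 (Y j)))"
    using assms by (intro finite_PiE) (auto simp: ladders_def ladder1_def)
  ultimately show ?thesis by (meson finite_imageI finite_subset)
qed

lemma ladder_succ_mem:
  assumes "finite L"
  shows "ladder_succ L y \<in> insert 1 L"
proof (cases "\<exists>z\<in>L. y < z")
  case True
  then have "Min {z \<in> L. y < z} \<in> {z \<in> L. y < z}" using assms by (intro Min_in) auto
  then show ?thesis using True by (simp add: ladder_succ_def)
qed (simp add: ladder_succ_def)

lemma ladder_succ_gt:
  assumes "ladder1 L" "y \<in> L"
  shows "y < ladder_succ L y"
proof (cases "\<exists>z\<in>L. y < z")
  case True
  then have "Min {z \<in> L. y < z} \<in> {z \<in> L. y < z}"
    using assms by (intro Min_in) (auto simp: ladder1_def)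
  then show ?thesis using True by (simp add: ladder_succ_def)
next
  case False
  then show ?thesis using assms by (auto simp: ladder_succ_def ladder1_def)
qed

lemma ladder_succ_le:
  assumes "ladder1 L" "z \<in> insert 1 L" "y < z"
  shows "ladder_succ L y \<le> z"
proof (cases "z \<in> L")
  case True
  then have "Min {z \<in> L. y < z} \<le> z" using assms by (intro Min_le) (auto simp: ladder1_def)
  then show ?thesis using True assms by (auto simp: ladder_succ_def)
next
  case False
  then have "z = 1" using assms by auto
  moreover have "ladder_succ L y \<le> 1"
    using ladder_succ_mem[of L y] assms(1) by (force simp: ladder1_def)
  ultimately show ?thesis by simp
qed

text \<open>
  The one-dimensional case of the reconstruction, anchored at \<open>1\<close>: the summand for \<open>c = 1\<close> is \<open>g 1\<close>,
  and the others telescope. The induction removes the least point of the range of summation.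
\<close>

lemma ladder_telescope:
  fixes g :: "real \<Rightarrow> real"
  assumes L: "ladder1 L" and x: "x \<in> insert 1 L"
  shows "(\<Sum>c\<in>{c \<in> insert 1 L. x \<le> c}. if c = 1 then g c else g c - g (ladder_succ L c)) = g x"
  using x
proof (induction "card {c \<in> insert 1 L. x \<le> c}" arbitrary: x rule: less_induct)
  case less
  have fin: "finite (insert 1 L)" using L by (auto simp: ladder1_def)
  show ?case
  proof (cases "x = 1")
    case True
    then have "{c \<in> insert 1 L. x \<le> c} = {1}" using L by (force simp: ladder1_def)
    then show ?thesis using True by simp
  next
    case False
    then have xL: "x \<in> L" using less.prems by simp
    let ?s = "ladder_succ L x"
    have s: "?s \<in> insert 1 L" "x < ?s"
      using ladder_succ_mem[of L x] ladder_succ_gt[OF L xL] L by (auto simp: ladder1_def)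
    have eq: "{c \<in> insert 1 L. x \<le> c} = insert x {c \<in> insert 1 L. ?s \<le> c}"
      using s ladder_succ_le[OF L] xL by (auto simp: order_le_less)
    have nin: "x \<notin> {c \<in> insert 1 L. ?s \<le> c}" using s by auto
    have finS: "finite {c \<in> insert 1 L. ?s \<le> c}" using fin by simp
    have "card {c \<in> insert 1 L. ?s \<le> c} < card {c \<in> insert 1 L. x \<le> c}"
      unfolding eq using nin finS by simp
    from less.hyps[OF this s(1)] show ?thesis
      unfolding eq sum.insert[OF finS nin] using False by simp
  qed
qed

text \<open>
  For a product function the alternating sum over the corners of a box is the expansion of a product
  of one-dimensional differences; the sign \<open>(-1) ^ card u\<close> orients them as \<open>a\<close> minus \<open>b\<close>, as the
  telescoping above requires.
\<close>

lemma Delta_prod: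
  fixes g :: "'n::finite \<Rightarrow> real \<Rightarrow> real"
  shows "(-1) ^ card u * Delta u (\<lambda>x. \<Prod>j\<in>UNIV. g j (x $ j)) a b =
    (\<Prod>j\<in>UNIV. if j \<in> u then g j (a $ j) - g j (b $ j) else g j (b $ j))"
proof -
  have split: "(\<Prod>j\<in>UNIV. h j) = (\<Prod>j\<in>u. h j) * (\<Prod>j\<in>-u. h j)" for h :: "'n \<Rightarrow> real"
    using prod.union_disjoint[of u "-u" h] by simp
  have "(\<Prod>j\<in>UNIV. g j (glue v a b $ j)) =
      (\<Prod>j\<in>v. g j (a $ j)) * (\<Prod>j\<in>u - v. g j (b $ j)) * (\<Prod>j\<in>-u. g j (b $ j))"
    if "v \<subseteq> u" for v
  proof -
    have "(\<Prod>j\<in>u. g j (glue v a b $ j)) =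
        (\<Prod>j\<in>v. g j (glue v a b $ j)) * (\<Prod>j\<in>u - v. g j (glue v a b $ j))"
      using prod.subset_diff[OF that, of "\<lambda>j. g j (glue v a b $ j)"] by (simp add: mult.commute)
    moreover have "(\<Prod>j\<in>v. g j (glue v a b $ j)) = (\<Prod>j\<in>v. g j (a $ j))"
      "(\<Prod>j\<in>u - v. g j (glue v a b $ j)) = (\<Prod>j\<in>u - v. g j (b $ j))"
      "(\<Prod>j\<in>-u. g j (glue v a b $ j)) = (\<Prod>j\<in>-u. g j (b $ j))"
      using that by (auto simp: glue_def intro!: prod.cong)
    ultimately show ?thesis using split[of "\<lambda>j. g j (glue v a b $ j)"] by simp
  qed
  then have "Delta u (\<lambda>x. \<Prod>j\<in>UNIV. g j (x $ j)) a b =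
      (\<Sum>v\<in>Pow u. (-1) ^ card v * (\<Prod>j\<in>v. g j (a $ j)) * (\<Prod>j\<in>u - v. g j (b $ j)))
        * (\<Prod>j\<in>-u. g j (b $ j))"
    by (simp add: Delta_def sum_distrib_right mult.assoc)
  also have "\<dots> = (\<Prod>j\<in>u. g j (b $ j) - g j (a $ j)) * (\<Prod>j\<in>-u. g j (b $ j))"
    by (subst prod_diff_conv_sum) simp_all
  finally have "(-1) ^ card u * Delta u (\<lambda>x. \<Prod>j\<in>UNIV. g j (x $ j)) a b =
      (\<Prod>j\<in>u. g j (a $ j) - g j (b $ j)) * (\<Prod>j\<in>-u. g j (b $ j))"
    using prod_uminus[of "\<lambda>j. g j (b $ j) - g j (a $ j)" u] by simp
  also have "\<dots> = (\<Prod>j\<in>UNIV. if j \<in> u then g j (a $ j) - g j (b $ j) else g j (b $ j))"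
    using split[of "\<lambda>j. if j \<in> u then g j (a $ j) - g j (b $ j) else g j (b $ j)"] by simp
  finally show ?thesis .
qed

text \<open>
  For product functions the sum over the grid factors into one-dimensional sums, and each of them
  telescopes.
\<close>

lemma reconstruction_prod:
  fixes g :: "'n::finite \<Rightarrow> real \<Rightarrow> real"
  assumes Y: "Y \<in> ladders" and x: "x \<in> closed_grid Y"
  shows "(\<Sum>z\<in>{z \<in> closed_grid Y. \<forall>j. x $ j \<le> z $ j}.
      (-1) ^ card (active z) * cell_diff Y (\<lambda>w. \<Prod>j\<in>UNIV. g j (w $ j)) z) = (\<Prod>j\<in>UNIV. g j (x $ j))"
proof -
  define h where "h j c = (if c = 1 then g j c else g j c - g j (ladder_succ (Y j) c))" for j c
  define S where "S j = {c \<in> insert 1 (Y j). x $ j \<le> c}" for j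
  have L: "ladder1 (Y j)" for j using Y by (simp add: ladders_def)
  have bij: "bij_betw vec_nth {z \<in> closed_grid Y. \<forall>j. x $ j \<le> z $ j} (PiE UNIV S)"
  proof (rule bij_betw_byWitness[where f' = vec_lambda])
  qed (auto simp: closed_grid_def S_def PiE_def extensional_def vec_lambda_inverse vec_nth_inverse)
  have "(\<Sum>z\<in>{z \<in> closed_grid Y. \<forall>j. x $ j \<le> z $ j}.
      (-1) ^ card (active z) * cell_diff Y (\<lambda>w. \<Prod>j\<in>UNIV. g j (w $ j)) z)
      = (\<Sum>z\<in>{z \<in> closed_grid Y. \<forall>j. x $ j \<le> z $ j}. \<Prod>j\<in>UNIV. h j (z $ j))"
    unfolding cell_diff_def Delta_prod
    by (intro sum.cong prod.cong refl) (auto simp: h_def active_def face_succ_def)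
  also have "\<dots> = (\<Sum>c\<in>PiE UNIV S. \<Prod>j\<in>UNIV. h j (c j))"
    by (rule sum.reindex_bij_betw[OF bij])
  also have "\<dots> = (\<Prod>j\<in>UNIV. \<Sum>c\<in>S j. h j c)"
    using L by (intro prod_sum_PiE[symmetric]) (auto simp: S_def ladder1_def)
  also have "\<dots> = (\<Prod>j\<in>UNIV. g j (x $ j))"
    unfolding h_def S_def using x
    by (intro prod.cong refl ladder_telescope L) (simp add: closed_grid_def)
  finally show ?thesis .
qed

lemma cell_diff_cong:
  assumes Y: "Y \<in> ladders" and z: "z \<in> closed_grid Y"
    and eq: "\<And>w. w \<in> closed_grid Y \<Longrightarrow> f w = g w"
  shows "cell_diff Y f z = cell_diff Y g z"
proof -
  have "face_succ Y (active z) z $ j \<in> insert 1 (Y j)" for j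
    using ladder_succ_mem[of "Y j"] Y by (auto simp: face_succ_def ladders_def ladder1_def)
  then have "glue v z (face_succ Y (active z) z) \<in> closed_grid Y" for v
    using z by (simp add: closed_grid_def glue_def)
  then show ?thesis by (simp add: cell_diff_def Delta_def eq)
qed

text \<open>
  Both sides are linear in \<open>f\<close> and depend on its values on the finite grid only, where \<open>f\<close> is a linear
  combination of indicators of single points. These are product functions.
\<close>

lemma reconstruction:
  assumes Y: "Y \<in> ladders" and x: "x \<in> closed_grid Y"
  shows "f x = (\<Sum>z\<in>{z \<in> closed_grid Y. \<forall>j. x $ j \<le> z $ j}. (-1) ^ card (active z) * cell_diff Y f z)"
proof -
  let ?G = "closed_grid Y" and ?U = "{z \<in> closed_grid Y. \<forall>j. x $ j \<le> z $ j}"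
  \<comment> \<open>The indicator of the point \<open>p\<close>, written as a product over the coordinates.\<close>
  define e where "e p w = (\<Prod>j\<in>UNIV. if w $ j = p $ j then 1 else 0 :: real)" for p w :: "real ^ 'a"
  have e: "e p w = (if w = p then 1 else 0)" for p w
  proof (cases "w = p")
    case False
    then obtain j where "w $ j \<noteq> p $ j" by (auto simp: vec_eq_iff)
    then show ?thesis using False by (auto simp: e_def intro!: prod_zero)
  qed (simp add: e_def)
  have expand: "f w = (\<Sum>p\<in>?G. f p * e p w)" if "w \<in> ?G" for w
  proof -
    have "(\<Sum>p\<in>?G. f p * e p w) = (\<Sum>p\<in>?G. if w = p then f p else 0)"
      by (intro sum.cong refl) (simp add: e)
    then show ?thesis using that finite_closed_grid[OF Y] by (simp add: sum.delta')
  qed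
  have "(\<Sum>z\<in>?U. (-1) ^ card (active z) * cell_diff Y f z)
      = (\<Sum>z\<in>?U. (-1) ^ card (active z) * cell_diff Y (\<lambda>w. \<Sum>p\<in>?G. f p * e p w) z)"
    using cell_diff_cong[OF Y _ expand] by (intro sum.cong) auto
  also have "\<dots> = (\<Sum>z\<in>?U. \<Sum>p\<in>?G. f p * ((-1) ^ card (active z) * cell_diff Y (e p) z))"
  proof (rule sum.cong[OF refl])
    fix z
    have "cell_diff Y (\<lambda>w. \<Sum>p\<in>?G. f p * e p w) z = (\<Sum>p\<in>?G. f p * cell_diff Y (e p) z)"
      unfolding cell_diff_def Delta_def sum_distrib_left
      by (subst sum.swap) (simp add: mult_ac)
    then show "(-1) ^ card (active z) * cell_diff Y (\<lambda>w. \<Sum>p\<in>?G. f p * e p w) z =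
        (\<Sum>p\<in>?G. f p * ((-1) ^ card (active z) * cell_diff Y (e p) z))"
      by (simp add: sum_distrib_left mult_ac)
  qed
  also have "\<dots> = (\<Sum>p\<in>?G. f p * (\<Sum>z\<in>?U. (-1) ^ card (active z) * cell_diff Y (e p) z))"
    by (subst sum.swap) (simp add: sum_distrib_left)
  also have "\<dots> = (\<Sum>p\<in>?G. f p * e p x)"
  proof -
    have "(\<Sum>z\<in>?U. (-1) ^ card (active z) * cell_diff Y (e p) z) = e p x" for p
      using reconstruction_prod[OF Y x, of "\<lambda>j c. if c = p $ j then 1 else 0"]
      by (simp add: e_def[abs_def])
    then show ?thesis by simp
  qed
  also have "\<dots> = f x" using expand[OF x] by simp
  finally show ?thesis by simp
qed

section \<open>Increments along disjoint coordinate segments\<close>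

text \<open>
  In the reconstructions of \<open>f p\<close> and \<open>f q\<close> all cells \<open>z \<ge> q\<close> cancel. A cell with \<open>z \<ge> p\<close> but not
  \<open>z \<ge> q\<close> can fail the latter in coordinate \<open>i\<close> only, as \<open>p\<close> and \<open>q\<close> agree elsewhere.
\<close>

lemma segment_increment_le:
  assumes Y: "Y \<in> ladders" and pq: "p \<in> closed_grid Y" "q \<in> closed_grid Y"
    and same: "\<And>j. j \<noteq> i \<Longrightarrow> p $ j = q $ j" and le: "p $ i \<le> q $ i"
  shows "\<bar>f q - f p\<bar> \<le> (\<Sum>z\<in>{z \<in> closed_grid Y. z $ i \<in> {p $ i..<q $ i}}. \<bar>cell_diff Y f z\<bar>)"
proof -
  let ?U = "\<lambda>x. {z \<in> closed_grid Y. \<forall>j. x $ j \<le> z $ j}"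
  let ?D = "\<lambda>z. (-1) ^ card (active z) * cell_diff Y f z"
  have fin: "finite (closed_grid Y)" by (rule finite_closed_grid[OF Y])
  have pq_le: "p $ j \<le> q $ j" for j using same le by (cases "j = i") auto
  have sub: "?U q \<subseteq> ?U p" using pq_le by (auto intro: order_trans)
  have "f p - f q = sum ?D (?U p - ?U q)"
    using reconstruction[OF Y pq(1), of f] reconstruction[OF Y pq(2), of f] sub fin
    by (simp add: sum_diff)
  then have "\<bar>f q - f p\<bar> \<le> (\<Sum>z\<in>?U p - ?U q. \<bar>?D z\<bar>)"
    using sum_abs[of ?D "?U p - ?U q"] by linarith
  also have "\<dots> = (\<Sum>z\<in>?U p - ?U q. \<bar>cell_diff Y f z\<bar>)"
    by (simp add: abs_mult power_abs)
  also have "\<dots> \<le> (\<Sum>z\<in>{z \<in> closed_grid Y. z $ i \<in> {p $ i..<q $ i}}. \<bar>cell_diff Y f z\<bar>)"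
  proof (rule sum_mono2)
    show "?U p - ?U q \<subseteq> {z \<in> closed_grid Y. z $ i \<in> {p $ i..<q $ i}}"
    proof
      fix z assume z: "z \<in> ?U p - ?U q"
      then obtain j where j: "z $ j < q $ j" by (auto simp: not_le)
      moreover have "p $ j \<le> z $ j" using z by auto
      ultimately have "j = i" using same[of j] by fastforce
      then show "z \<in> {z \<in> closed_grid Y. z $ i \<in> {p $ i..<q $ i}}" using z j by auto
    qed
  qed (use fin in auto)
  finally show ?thesis .
qed

lemma ladder_face_eq:
  assumes "Y \<in> ladders"
  shows "ladder_face Y u = {z \<in> closed_grid Y. active z = u}"
proof (intro set_eqI iffI)
  fix z assume "z \<in> ladder_face Y u"
  then obtain y where z: "z = glue u y 1" and y: "\<And>j. y $ j \<in> Y j"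
    by (auto simp: ladder_face_def ladder_points_def)
  have "y $ j \<noteq> 1" for j using y[of j] assms by (force simp: ladders_def ladder1_def)
  then show "z \<in> {z \<in> closed_grid Y. active z = u}"
    using y by (auto simp: z closed_grid_def active_def glue_def)
next
  fix z assume z: "z \<in> {z \<in> closed_grid Y. active z = u}"
  have "z = glue u (glue u z 0) 1"
    using z by (auto simp: glue_def vec_eq_iff active_def)
  moreover have "glue u z 0 \<in> ladder_points Y"
    using z assms by (auto simp: ladder_points_def glue_def active_def closed_grid_def
        ladders_def ladder1_def)
  ultimately show "z \<in> ladder_face Y u" by (auto simp: ladder_face_def)
qed

lemma sum_cell_diff_le_HK:
  assumes Y: "Y \<in> ladders" and HK: "HK f < \<infinity>"
  shows "(\<Sum>z\<in>{z \<in> closed_grid Y. active z \<noteq> {}}. \<bar>cell_diff Y f z\<bar>) \<le> enn2real (HK f)"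
proof -
  let ?A = "{z \<in> closed_grid Y. active z \<noteq> {}}" and ?T = "{u :: 'a set. u \<noteq> {}}"
  have "(\<Sum>z\<in>?A. \<bar>cell_diff Y f z\<bar>) =
      (\<Sum>u\<in>?T. \<Sum>z\<in>{z \<in> ?A. active z = u}. \<bar>cell_diff Y f z\<bar>)"
    using finite_closed_grid[OF Y] by (intro sum.group[symmetric]) auto
  also have "\<dots> = (\<Sum>u\<in>?T. ladder_variation Y u f)"
    unfolding ladder_variation_def ladder_face_eq[OF Y]
    by (intro sum.cong) (auto simp: cell_diff_def)
  finally have eq: "(\<Sum>z\<in>?A. \<bar>cell_diff Y f z\<bar>) = (\<Sum>u\<in>?T. ladder_variation Y u f)" .
  have nn: "ladder_variation Y u f \<ge> 0" for u by (simp add: ladder_variation_def sum_nonneg)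
  have "ennreal (\<Sum>u\<in>?T. ladder_variation Y u f) = (\<Sum>u\<in>?T. ennreal (ladder_variation Y u f))"
    using nn by (simp add: sum_ennreal)
  also have "\<dots> \<le> HK f"
    unfolding HK_def by (intro sum_mono SUP_upper Y)
  finally have "enn2real (ennreal (\<Sum>u\<in>?T. ladder_variation Y u f)) \<le> enn2real (HK f)"
    using HK by (intro enn2real_mono) (auto simp: infinity_ennreal_def)
  then show ?thesis unfolding eq using nn by (simp add: sum_nonneg)
qed

text \<open>
  Families of segments parallel to the \<open>i\<close>-axis, as pairs of end points. The half-open intervals allow
  consecutive segments to meet in their \<open>i\<close>-th coordinate.
\<close>

definition segment_families :: "'n::finite \<Rightarrow> real \<Rightarrow> ((real ^ 'n) \<times> (real ^ 'n)) set set" where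
  "segment_families i t = {K. finite K \<and>
     (\<forall>k\<in>K. fst k \<in> cbox 0 1 \<and> snd k \<in> cbox 0 1 \<and> (\<forall>j. j \<noteq> i \<longrightarrow> fst k $ j = snd k $ j) \<and>
       fst k $ i \<le> snd k $ i \<and> snd k $ i \<le> t) \<and>
     disjoint_family_on (\<lambda>k. {fst k $ i..<snd k $ i}) K}"

text \<open>
  The uniformity in the remaining coordinates comes from here: a single ladder can contain the
  coordinates of all segments at once, and the cells used by different segments lie in disjoint slabs.
\<close>

lemma segment_family_sum_le_HK:
  fixes f :: "real ^ 'n::finite \<Rightarrow> real"
  assumes HK: "HK f < \<infinity>" and K: "K \<in> segment_families i t"
  shows "(\<Sum>k\<in>K. \<bar>f (snd k) - f (fst k)\<bar>) \<le> enn2real (HK f)"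
proof -
  have finK: "finite K" and disj: "disjoint_family_on (\<lambda>k. {fst k $ i..<snd k $ i}) K"
    and cube: "\<And>k j. k \<in> K \<Longrightarrow> fst k $ j \<in> {0..1} \<and> snd k $ j \<in> {0..1}"
    and same: "\<And>k j. k \<in> K \<Longrightarrow> j \<noteq> i \<Longrightarrow> fst k $ j = snd k $ j"
    and le: "\<And>k. k \<in> K \<Longrightarrow> fst k $ i \<le> snd k $ i"
    using K by (auto simp: segment_families_def mem_box_cart)
  \<comment> \<open>A ladder must contain \<open>0\<close> and omit \<open>1\<close>; the closed grid has \<open>1\<close> back, so it contains all end points.\<close>
  define Y where "Y j = insert 0 (((\<lambda>k. fst k $ j) ` K \<union> (\<lambda>k. snd k $ j) ` K) - {1})" for j
  have Y: "Y \<in> ladders"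
    using finK cube by (fastforce simp: ladders_def ladder1_def Y_def order_le_less)
  have fin: "finite (closed_grid Y)" by (rule finite_closed_grid[OF Y])
  have grid: "fst k \<in> closed_grid Y" "snd k \<in> closed_grid Y" if "k \<in> K" for k
    using that by (auto simp: closed_grid_def Y_def)
  let ?S = "\<lambda>k. {z \<in> closed_grid Y. z $ i \<in> {fst k $ i..<snd k $ i}}"
  have "(\<Sum>k\<in>K. \<bar>f (snd k) - f (fst k)\<bar>) \<le> (\<Sum>k\<in>K. \<Sum>z\<in>?S k. \<bar>cell_diff Y f z\<bar>)"
    using segment_increment_le[OF Y] grid same le by (intro sum_mono) blast
  also have "\<dots> = (\<Sum>z\<in>(\<Union>k\<in>K. ?S k). \<bar>cell_diff Y f z\<bar>)"
  proof (rule sum.UNION_disjoint[symmetric])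
    show "\<forall>k\<in>K. \<forall>l\<in>K. k \<noteq> l \<longrightarrow> ?S k \<inter> ?S l = {}"
      using disj unfolding disjoint_family_on_def by blast
  qed (use finK fin in simp_all)
  also have "\<dots> \<le> (\<Sum>z\<in>{z \<in> closed_grid Y. active z \<noteq> {}}. \<bar>cell_diff Y f z\<bar>)"
  proof (rule sum_mono2)
    show "(\<Union>k\<in>K. ?S k) \<subseteq> {z \<in> closed_grid Y. active z \<noteq> {}}"
    proof
      fix z assume "z \<in> (\<Union>k\<in>K. ?S k)"
      then obtain k where "k \<in> K" "z \<in> closed_grid Y" "z $ i < snd k $ i" by auto
      moreover from this have "z $ i \<noteq> 1" using cube[of k i] by auto
      ultimately show "z \<in> {z \<in> closed_grid Y. active z \<noteq> {}}" by (auto simp: active_def)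
    qed
  qed (use fin in auto)
  also have "\<dots> \<le> enn2real (HK f)" by (rule sum_cell_diff_le_HK[OF Y HK])
  finally show ?thesis .
qed

section \<open>Control by one monotone function per coordinate\<close>

definition coord_variation :: "(real ^ 'n::finite \<Rightarrow> real) \<Rightarrow> 'n \<Rightarrow> real \<Rightarrow> real" where
  "coord_variation f i t = (SUP K\<in>segment_families i t. \<Sum>k\<in>K. \<bar>f (snd k) - f (fst k)\<bar>)"

lemma bdd_above_segment_sums:
  assumes "HK f < \<infinity>"
  shows "bdd_above ((\<lambda>K. \<Sum>k\<in>K. \<bar>f (snd k) - f (fst k)\<bar>) ` segment_families i t)"
  using segment_family_sum_le_HK[OF assms] by (intro bdd_aboveI2)

lemma empty_segment_family: "{} \<in> segment_families i t"
  by (simp add: segment_families_def disjoint_family_on_def)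

lemma mono_coord_variation:
  assumes "HK f < \<infinity>"
  shows "mono (coord_variation f i)"
proof (rule monoI)
  fix s t :: real assume "s \<le> t"
  then have "segment_families i s \<subseteq> segment_families i t"
    by (fastforce simp: segment_families_def)
  then show "coord_variation f i s \<le> coord_variation f i t"
    unfolding coord_variation_def
    by (intro cSUP_subset_mono bdd_above_segment_sums[OF assms] order_refl)
      (use empty_segment_family in blast)
qed

text \<open>
  Any family below \<open>p $ i\<close> remains admissible below \<open>q $ i\<close> after the segment from \<open>p\<close> to \<open>q\<close> is added
  to it.
\<close>

lemma coord_variation_increment:
  assumes HK: "HK f < \<infinity>" and cube: "p \<in> cbox 0 1" "q \<in> cbox 0 1"
    and same: "\<And>j. j \<noteq> i \<Longrightarrow> p $ j = q $ j" and less: "p $ i < q $ i"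
  shows "\<bar>f q - f p\<bar> \<le> coord_variation f i (q $ i) - coord_variation f i (p $ i)"
proof -
  have "coord_variation f i (p $ i) \<le> coord_variation f i (q $ i) - \<bar>f q - f p\<bar>"
    unfolding coord_variation_def[of f i "p $ i"]
  proof (rule cSUP_least)
    show "segment_families i (p $ i) \<noteq> {}" using empty_segment_family by blast
  next
    fix K assume K: "K \<in> segment_families i (p $ i)"
    have new: "(p, q) \<notin> K" and finK: "finite K"
      using K less by (force simp: segment_families_def)+
    have "insert (p, q) K \<in> segment_families i (q $ i)"
    proof -
      have "disjoint_family_on (\<lambda>k. {fst k $ i..<snd k $ i}) (insert (p, q) K)"
        using K new by (subst disjoint_family_on_insert)
          (fastforce simp: segment_families_def)+
      then show ?thesis
        using K cube same less by (fastforce simp: segment_families_def)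
    qed
    then have "(\<Sum>k\<in>insert (p, q) K. \<bar>f (snd k) - f (fst k)\<bar>) \<le> coord_variation f i (q $ i)"
      unfolding coord_variation_def by (intro cSUP_upper bdd_above_segment_sums HK)
    then show "(\<Sum>k\<in>K. \<bar>f (snd k) - f (fst k)\<bar>) \<le> coord_variation f i (q $ i) - \<bar>f q - f p\<bar>"
      using new finK by simp
  qed
  then show ?thesis by simp
qed

text \<open>
  One passes from \<open>y\<close> to \<open>x\<close> by changing one coordinate at a time; the bound for each step does not
  depend on the coordinates that were changed before.
\<close>

lemma increment_le_sum_coord_variation:
  assumes HK: "HK f < \<infinity>" and x: "x \<in> cbox 0 1" and y: "y \<in> cbox 0 1"
  shows "\<bar>f x - f y\<bar> \<le> (\<Sum>i\<in>UNIV. \<bar>coord_variation f i (x $ i) - coord_variation f i (y $ i)\<bar>)"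
proof -
  have cube: "glue A x y \<in> cbox 0 1" for A
    using x y by (simp add: mem_box_cart glue_def)
  have "\<bar>f (glue A x y) - f y\<bar> \<le>
      (\<Sum>i\<in>A. \<bar>coord_variation f i (x $ i) - coord_variation f i (y $ i)\<bar>)" for A
  proof (induction A rule: finite_induct[OF finite])
    case 1
    have "glue {} x y = y" by (simp add: glue_def vec_eq_iff)
    then show ?case by simp
  next
    case (2 i A)
    let ?p = "glue A x y" and ?q = "glue (insert i A) x y"
    have same: "?p $ j = ?q $ j" if "j \<noteq> i" for j using that by (simp add: glue_def)
    have pi: "?p $ i = y $ i" and qi: "?q $ i = x $ i" using 2 by (simp_all add: glue_def)
    consider "?p $ i = ?q $ i" | "?p $ i < ?q $ i" | "?q $ i < ?p $ i" by linarith
    then have "\<bar>f ?q - f ?p\<bar> \<le> \<bar>coord_variation f i (x $ i) - coord_variation f i (y $ i)\<bar>"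
    proof cases
      case 1
      then have "?p = ?q" using same by (metis vec_eq_iff)
      then show ?thesis by simp
    next
      case 2
      from coord_variation_increment[OF HK cube cube same this] show ?thesis
        unfolding pi qi by linarith
    next
      case 3
      from coord_variation_increment[OF HK cube cube same[symmetric] this] show ?thesis
        unfolding pi qi by linarith
    qed
    then show ?case using 2 by simp
  qed
  moreover have "glue UNIV x y = x" by (simp add: glue_def vec_eq_iff)
  ultimately show ?thesis by metis
qed

section \<open>Measurability\<close>

text \<open>
  The hypothesis makes \<open>f\<close> a Lipschitz function of \<open>\<Phi>\<close>. The range of \<open>\<Phi>\<close> need not be a Borel set, but
  the function extends continuously to its closure by completeness of the codomain.
\<close>

lemma borel_measurable_of_dist_le:
  fixes f :: "'a \<Rightarrow> 'b::complete_space" and \<Phi> :: "'a \<Rightarrow> 'c::metric_space"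
  assumes \<Phi>: "\<Phi> \<in> borel_measurable M"
    and dist: "\<And>x y. x \<in> space M \<Longrightarrow> y \<in> space M \<Longrightarrow> dist (f x) (f y) \<le> C * dist (\<Phi> x) (\<Phi> y)"
  shows "f \<in> borel_measurable M"
proof -
  define S where "S = \<Phi> ` space M"
  \<comment> \<open>The choice of preimages does not matter: \<open>f\<close> is constant on the fibres of \<open>\<Phi>\<close>.\<close>
  define r where "r = inv_into (space M) \<Phi>"
  have r: "r z \<in> space M" "\<Phi> (r z) = z" if "z \<in> S" for z
    using that by (simp_all add: S_def r_def inv_into_into f_inv_into_f)
  have "\<bar>C\<bar>-lipschitz_on S (f \<circ> r)"
  proof (rule lipschitz_onI)
    fix z w assume "z \<in> S" "w \<in> S"
    then have "dist (f (r z)) (f (r w)) \<le> C * dist z w" using dist[of "r z" "r w"] r by simp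
    also have "\<dots> \<le> \<bar>C\<bar> * dist z w" by (intro mult_right_mono) auto
    finally show "dist ((f \<circ> r) z) ((f \<circ> r) w) \<le> \<bar>C\<bar> * dist z w" by simp
  qed simp
  then obtain g where g: "uniformly_continuous_on (closure S) g" "\<And>z. z \<in> S \<Longrightarrow> (f \<circ> r) z = g z"
    using uniformly_continuous_on_extension_on_closure[OF lipschitz_on_uniformly_continuous]
    by metis
  have "g \<in> borel_measurable (restrict_space borel (closure S))"
    using g(1) by (intro borel_measurable_continuous_on_restrict uniformly_continuous_imp_continuous)
  moreover have "\<Phi> \<in> measurable M (restrict_space borel (closure S))"
    using \<Phi> closure_subset[of S] by (intro measurable_restrict_space2) (auto simp: S_def)
  ultimately have "(\<lambda>x. g (\<Phi> x)) \<in> borel_measurable M" by (rule measurable_compose_rev)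
  moreover have "g (\<Phi> x) = f x" if "x \<in> space M" for x
  proof -
    have "\<Phi> x \<in> S" using that by (simp add: S_def)
    then have "dist (f (r (\<Phi> x))) (f x) \<le> C * dist (\<Phi> x) (\<Phi> x)"
      using dist[of "r (\<Phi> x)" x] r[of "\<Phi> x"] that by simp
    then show ?thesis using g(2)[OF \<open>\<Phi> x \<in> S\<close>] by simp
  qed
  ultimately show ?thesis by (simp cong: measurable_cong)
qed

theorem theorem3p1:
  fixes f :: "real ^ 'n::finite \<Rightarrow> real"
  assumes "HK f < \<infinity>"
  shows "f \<in> measurable (restrict_space borel (cbox 0 1)) borel"
proof -
  define \<Phi> :: "real ^ 'n \<Rightarrow> real ^ 'n" where "\<Phi> x = (\<chi> i. coord_variation f i (x $ i))" for x
  have coord: "(\<lambda>x. coord_variation f i (x $ i)) \<in> borel_measurable borel" for i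
  proof (rule measurable_compose[OF _ borel_measurable_mono[OF mono_coord_variation[OF assms]]])
    show "(\<lambda>x :: real ^ 'n. x $ i) \<in> borel_measurable borel"
      by (intro borel_measurable_continuous_onI continuous_intros)
  qed
  have "\<Phi> \<in> borel_measurable borel"
    unfolding borel_measurable_euclidean_space[of \<Phi>]
    using coord by (auto simp: \<Phi>_def Basis_vec_def inner_axis)
  then have "\<Phi> \<in> borel_measurable (restrict_space borel (cbox 0 1))"
    by (rule measurable_restrict_space1)
  then show ?thesis
  proof (rule borel_measurable_of_dist_le)
    fix x y :: "real ^ 'n"
    assume xy: "x \<in> space (restrict_space borel (cbox 0 1))" "y \<in> space (restrict_space borel (cbox 0 1))"
    then have "dist (f x) (f y) \<le> (\<Sum>i\<in>UNIV. \<bar>\<Phi> x $ i - \<Phi> y $ i\<bar>)"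
      using increment_le_sum_coord_variation[OF assms, of x y]
      by (simp add: dist_real_def \<Phi>_def space_restrict_space)
    also have "\<dots> \<le> (\<Sum>i\<in>(UNIV :: 'n set). dist (\<Phi> x) (\<Phi> y))"
      using component_le_norm_cart[of "\<Phi> x - \<Phi> y"] by (intro sum_mono) (simp add: dist_norm)
    finally show "dist (f x) (f y) \<le> real CARD('n) * dist (\<Phi> x) (\<Phi> y)" by simp
  qed
qed

end
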